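(* Let $A$ be a Type-II bdsw matrix. Then $A\in\mathbf{Q}$ (equivalently, $A\in\mathbf{P}$; equivalently, $A\in\mathbf{R}^*$) if and only if $\det A>0$.
   Context: A matrix $A=[a_{ij}]\in\mathbb{R}^{n\times n}$, $n\ge 2$, is a bidiagonal southwest (bdsw) matrix if $a_{ij}=0$ unless $j=i$, or $j=i+1$, or $(i,j)=(n,1)$. In row $i<n$ the relevant off-diagonal entry is $a_{i(i+1)}$; in row $n$ it is $a_{n1}$. A Type-II bdsw matrix is a bdsw matrix in which, in each row, the diagonal entry is positive and the relevant off-diagonal entry is negative. For $A\in\mathbb{R}^{n\times n}$ and $q\in\mathbb{R}^n$, $\mathrm{LCP}(A,q)$ is the problem of finding $x\in\mathbb{R}^n$ with $x\ge 0$, $Ax+q\ge 0$ and $x^\top(Ax+q)=0$ (inequalities between vectors are componentwise; $d>0$ means all components of $d$ are positive). - $A\in\mathbf{Q}$ if $\mathrm{LCP}(A,q)$ has a solution for every $q\in\mathbb{R}^n$. - $A\in\mathbf{P}$ if all principal minors of $A$ are positive. - $A\in\mathbf{R}_0$ if $x=0$ is the only solution of $\mathrm{LCP}(A,0)$. - $A\in\mathbf{E}_0$ if for every $d>0$ in $\mathbb{R}^n$, $x=0$ is the only solution of $\mathrm{LCP}(A,d)$. - $A\in\mathbf{R}^*$ if $A\in\mathbf{R}_0$ and $A\in\mathbf{E}_0$. *)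

theory Defs
  imports "Jordan_Normal_Form.Determinant" "Jordan_Normal_Form.DL_Submatrix"
begin

(* Rows and columns are indexed by 0, ..., n-1, so the southwest corner (n,1) is (n-1,0). *)

definition bdsw :: "nat \<Rightarrow> real mat \<Rightarrow> bool" where
  "bdsw n A \<longleftrightarrow> 2 \<le> n \<and> A \<in> carrier_mat n n \<and>
     (\<forall>i<n. \<forall>j<n. \<not> (j = i \<or> j = i + 1 \<or> (i = n - 1 \<and> j = 0)) \<longrightarrow> A $$ (i, j) = 0)"

definition type_II_bdsw :: "nat \<Rightarrow> real mat \<Rightarrow> bool" where
  "type_II_bdsw n A \<longleftrightarrow> bdsw n A \<and>
     (\<forall>i<n. 0 < A $$ (i, i)) \<and>
     (\<forall>i<n - 1. A $$ (i, i + 1) < 0) \<and>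
     A $$ (n - 1, 0) < 0"

(* The solution set of LCP(A,q); the order on vectors is the componentwise one. *)
definition LCP :: "nat \<Rightarrow> real mat \<Rightarrow> real vec \<Rightarrow> real vec set" where
  "LCP n A q = {x \<in> carrier_vec n.
     0\<^sub>v n \<le> x \<and> 0\<^sub>v n \<le> A *\<^sub>v x + q \<and> x \<bullet> (A *\<^sub>v x + q) = 0}"

definition Q_matrices :: "nat \<Rightarrow> real mat set" where
  "Q_matrices n = {A \<in> carrier_mat n n. \<forall>q \<in> carrier_vec n. LCP n A q \<noteq> {}}"

definition P_matrices :: "nat \<Rightarrow> real mat set" where
  "P_matrices n = {A \<in> carrier_mat n n. \<forall>I \<subseteq> {0..<n}. I \<noteq> {} \<longrightarrow> 0 < det (submatrix A I I)}"

definition R0_matrices :: "nat \<Rightarrow> real mat set" where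
  "R0_matrices n = {A \<in> carrier_mat n n. LCP n A (0\<^sub>v n) = {0\<^sub>v n}}"

(* d > 0 is spelled out componentwise: the strict order on vectors
   only says that d is nonnegative and nonzero. *)
definition E0_matrices :: "nat \<Rightarrow> real mat set" where
  "E0_matrices n = {A \<in> carrier_mat n n.
     \<forall>d \<in> carrier_vec n. (\<forall>i<n. 0 < d $ i) \<longrightarrow> LCP n A d = {0\<^sub>v n}}"

definition Rstar_matrices :: "nat \<Rightarrow> real mat set" where
  "Rstar_matrices n = R0_matrices n \<inter> E0_matrices n"

end

theory Submission
  imports Defs "Jordan_Normal_Form.Char_Poly"
begin

text \<open>Let \<open>D\<close> be the product of the diagonal entries of \<open>A\<close> and \<open>O\<close> the product of the absolute
  values of the off-diagonal ones, so that \<open>det A = D - O\<close>. Solving \<open>a\<^sub>i v\<^sub>i = c b\<^sub>i v\<^sub>i\<^sub>+\<^sub>1\<close> around the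
  cycle is possible for exactly one \<open>c > 0\<close>, namely \<open>c\<^sup>n = D / O\<close>, and gives a positive vector \<open>v\<close> with
  \<open>(A v)\<^sub>i = a\<^sub>i v\<^sub>i (1 - 1/c)\<close>: all components of \<open>A v\<close> have the sign of \<open>det A\<close>.
  Since the off-diagonal entries of \<open>A\<close> are nonpositive, a positive \<open>v\<close> with \<open>A v > 0\<close> yields a
  maximum principle, from which \<open>\<^bold>R\<^sup>*\<close> and \<open>\<^bold>P\<close> follow, while \<open>\<^bold>Q\<close> follows by taking the
  componentwise infimum of the feasible set. If \<open>A v \<le> 0\<close>, then \<open>v\<close> solves \<open>LCP(A, -A v)\<close>,
  and \<open>LCP(A, -(1,\<dots>,1))\<close> is infeasible.\<close>

section \<open>Z-matrices and the maximum principle\<close>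

definition Z_matrix :: "nat \<Rightarrow> real mat \<Rightarrow> bool" where
  "Z_matrix n A \<longleftrightarrow> A \<in> carrier_mat n n \<and> (\<forall>i<n. \<forall>j<n. i \<noteq> j \<longrightarrow> A $$ (i, j) \<le> 0)"

lemma Z_matrixD:
  assumes "Z_matrix n A"
  shows "A \<in> carrier_mat n n" "\<And>i j. i < n \<Longrightarrow> j < n \<Longrightarrow> i \<noteq> j \<Longrightarrow> A $$ (i, j) \<le> 0"
  using assms by (auto simp: Z_matrix_def)

lemma mult_mat_vec_index_sum:
  assumes "A \<in> carrier_mat n n" "x \<in> carrier_vec n" "i < n"
  shows "(A *\<^sub>v x) $ i = (\<Sum>j<n. A $$ (i, j) * x $ j)"
  using assms by (auto simp: scalar_prod_def atLeast0LessThan intro!: sum.cong)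

text \<open>Each off-diagonal term \<open>A $$ (i, j) * (y $ j - x $ j)\<close> is nonpositive, so
  the diagonal term alone bounds the change in row \<open>i\<close>.\<close>

lemma Z_matrix_mult_le:
  assumes Z: "Z_matrix n A" and x: "x \<in> carrier_vec n" and y: "y \<in> carrier_vec n"
    and i: "i < n" and le: "\<And>j. j < n \<Longrightarrow> x $ j \<le> y $ j"
  shows "(A *\<^sub>v y) $ i \<le> (A *\<^sub>v x) $ i + A $$ (i, i) * (y $ i - x $ i)"
proof -
  note A = Z_matrixD(1)[OF Z]
  have "(A *\<^sub>v y) $ i - (A *\<^sub>v x) $ i = (\<Sum>j<n. A $$ (i, j) * (y $ j - x $ j))"
    by (simp add: mult_mat_vec_index_sum[OF A _ i] x y sum_subtractf right_diff_distrib)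
  also have "\<dots> \<le> (\<Sum>j<n. if j = i then A $$ (i, i) * (y $ i - x $ i) else 0)"
    using Z_matrixD(2)[OF Z i] le by (intro sum_mono) (auto intro: mult_nonpos_nonneg)
  also have "\<dots> = A $$ (i, i) * (y $ i - x $ i)"
    using i by simp
  finally show ?thesis by simp
qed

text \<open>If \<open>x\<close> had a positive component, take the least multiple \<open>t v\<close>
  lying above \<open>x\<close>. It touches \<open>x\<close> at some \<open>i\<close>, where the
  diagonal correction of \<open>Z_matrix_mult_le\<close> vanishes, so
  \<open>(A x)_i >= t (A v)_i > 0\<close> although \<open>x $ i > 0\<close>.\<close>

lemma Z_matrix_maximum_principle:
  assumes Z: "Z_matrix n A" and v: "v \<in> carrier_vec n" "\<And>i. i < n \<Longrightarrow> 0 < v $ i"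
    and Av: "\<And>i. i < n \<Longrightarrow> 0 < (A *\<^sub>v v) $ i"
    and x: "x \<in> carrier_vec n" "\<And>i. i < n \<Longrightarrow> 0 < x $ i \<Longrightarrow> (A *\<^sub>v x) $ i \<le> 0"
    and k: "k < n"
  shows "x $ k \<le> 0"
proof (rule ccontr)
  assume "\<not> x $ k \<le> 0"
  define r where "r i = x $ i / v $ i" for i
  define t where "t = Max (r ` {..<n})"
  have "t \<in> r ` {..<n}" unfolding t_def using k by (intro Max_in) auto
  then obtain i where i: "i < n" "t = r i" by auto
  have le: "r j \<le> t" if "j < n" for j unfolding t_def using that by simp
  have "0 < r k" using \<open>\<not> x $ k \<le> 0\<close> v(2)[OF k] by (simp add: r_def)
  with le[OF k] have t: "0 < t" by simp
  have xi: "x $ i = t * v $ i" using i v(2)[OF i(1)] by (simp add: r_def)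
  have "(A *\<^sub>v (t \<cdot>\<^sub>v v)) $ i \<le> (A *\<^sub>v x) $ i + A $$ (i, i) * ((t \<cdot>\<^sub>v v) $ i - x $ i)"
  proof (rule Z_matrix_mult_le[OF Z x(1) _ i(1)])
    show "x $ j \<le> (t \<cdot>\<^sub>v v) $ j" if "j < n" for j
      using le[OF that] v(2)[OF that] v(1) that by (simp add: r_def field_simps)
  qed (use v in simp)
  moreover have "A *\<^sub>v (t \<cdot>\<^sub>v v) = t \<cdot>\<^sub>v (A *\<^sub>v v)"
    using Z_matrixD(1)[OF Z] v(1) by (rule mult_mat_vec)
  ultimately have "t * (A *\<^sub>v v) $ i \<le> (A *\<^sub>v x) $ i"
    using i(1) v(1) xi Z_matrixD(1)[OF Z] by simp
  moreover have "0 < x $ i" using xi t v(2)[OF i(1)] by simp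
  ultimately show False using x(2)[OF i(1)] mult_pos_pos[OF t Av[OF i(1)]] by simp
qed

section \<open>Positive determinants and principal minors\<close>

lemma Z_matrix_det_pos:
  assumes Z: "Z_matrix n A" and v: "v \<in> carrier_vec n" "\<And>i. i < n \<Longrightarrow> 0 < v $ i"
    and Av: "\<And>i. i < n \<Longrightarrow> 0 < (A *\<^sub>v v) $ i"
  shows "0 < det A"
proof (rule ccontr)
  assume "\<not> 0 < det A"
  note A = Z_matrixD(1)[OF Z]
  have mA: "- A \<in> carrier_mat n n" using A by simp
  \<comment> \<open>\<open>p t = det (t I + A)\<close> is monic and, by the maximum principle, has no root \<open>t \<ge> 0\<close>.\<close>
  define p where "p = char_poly (- A)"
  have "poly p 0 = det A"
    unfolding p_def char_poly_def
    by (rule poly_det_cong[OF A char_poly_matrix_closed[OF mA]])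
      (use A in \<open>simp add: char_poly_matrix_def\<close>)
  then have p0: "poly p 0 \<le> 0" using \<open>\<not> 0 < det A\<close> by simp
  have "lead_coeff p = 1"
    using degree_monic_char_poly[OF mA] by (simp add: p_def)
  then obtain m where m: "\<And>k. m \<le> k \<Longrightarrow> 1 \<le> poly p k"
    using poly_pinfty_gt_lc[of p] by auto
  \<comment> \<open>\<open>p\<close> is at most 0 at 0 and at least 1 at \<open>max 0 m\<close>; the
    maximum guards against a negative \<open>m\<close>.\<close>
  have "\<exists>k\<ge>0. k \<le> max 0 m \<and> poly p k = 0"
    using m[of "max 0 m"] p0 by (intro IVT') (auto intro: continuous_intros)
  then obtain k where k: "0 \<le> k" "poly p k = 0" by blast
  then have "eigenvalue (- A) k"
    using eigenvalue_root_char_poly[OF mA] by (simp add: p_def)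
  then obtain x where x: "x \<in> carrier_vec n" "x \<noteq> 0\<^sub>v n" "- A *\<^sub>v x = k \<cdot>\<^sub>v x"
    using A by (auto simp: eigenvalue_def eigenvector_def)
  have Ax: "(A *\<^sub>v x) $ i = - (k * x $ i)" if "i < n" for i
  proof -
    have "(- A *\<^sub>v x) $ i = - (A *\<^sub>v x) $ i"
      using A mA x(1) that by (simp add: mult_mat_vec_index_sum[of _ n] sum_negf)
    then show ?thesis using x(1) x(3) that by simp
  qed
  have Amx: "(A *\<^sub>v (- x)) $ i = k * x $ i" if "i < n" for i
    using Ax[OF that] A x(1) that
    by (simp add: mult_mat_vec_index_sum[of _ n] sum_negf)
  \<comment> \<open>Where \<open>x $ i > 0\<close>, \<open>(A x)_i = - k x_i <= 0\<close>, so
    \<open>x <= 0\<close>. Then \<open>A (- x) = k x <= 0\<close> everywhere, and the principle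
    applies to \<open>- x\<close> as well.\<close>
  have le: "x $ i \<le> 0" if "i < n" for i
    by (rule Z_matrix_maximum_principle[OF Z v Av x(1) _ that]) (use k(1) Ax in auto)
  have ge: "(- x) $ i \<le> 0" if "i < n" for i
    by (rule Z_matrix_maximum_principle[OF Z v Av _ _ that])
      (use k(1) Amx le x(1) in \<open>auto intro: mult_nonneg_nonpos\<close>)
  have "x $ i = 0" if "i < n" for i
    using le[OF that] ge[OF that] x(1) that by simp
  then have "x = 0\<^sub>v n" using x(1) by (intro eq_vecI) auto
  with x(2) show False by simp
qed

lemma submatrix_index_subset:
  assumes "A \<in> carrier_mat n n" "I \<subseteq> {0..<n}"
  shows "submatrix A I I \<in> carrier_mat (card I) (card I)"
    and "\<And>i j. i < card I \<Longrightarrow> j < card I \<Longrightarrow> submatrix A I I $$ (i, j) = A $$ (pick I i, pick I j)"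
proof -
  have "{i. i < n \<and> i \<in> I} = I" using assms(2) by auto
  then show "submatrix A I I \<in> carrier_mat (card I) (card I)"
    "\<And>i j. i < card I \<Longrightarrow> j < card I \<Longrightarrow> submatrix A I I $$ (i, j) = A $$ (pick I i, pick I j)"
    using assms(1) by (auto simp: submatrix_def)
qed

lemma inj_on_pick: "inj_on (pick I) {..<card I}"
  by (intro linorder_inj_onI') (metis less_irrefl lessThan_iff pick_mono_le)

lemma bij_betw_pick:
  assumes "finite I"
  shows "bij_betw (pick I) {..<card I} I"
  unfolding bij_betw_def
proof
  show "inj_on (pick I) {..<card I}" by (rule inj_on_pick)
  show "pick I ` {..<card I} = I"
    using assms pick_in_set_le by (intro card_subset_eq) (auto simp: card_image[OF inj_on_pick])
qed

text \<open>The restriction of \<open>v\<close> to \<open>I\<close> serves as the positive vector of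
  the principal submatrix: the columns dropped from a row in \<open>I\<close> carry nonpositive
  off-diagonal entries, so the row values can only grow.\<close>

lemma Z_matrix_P:
  assumes Z: "Z_matrix n A" and v: "v \<in> carrier_vec n" "\<And>i. i < n \<Longrightarrow> 0 < v $ i"
    and Av: "\<And>i. i < n \<Longrightarrow> 0 < (A *\<^sub>v v) $ i"
  shows "A \<in> P_matrices n"
  unfolding P_matrices_def
proof (intro CollectI conjI allI impI)
  note A = Z_matrixD(1)[OF Z]
  show "A \<in> carrier_mat n n" by (rule A)
  fix I assume I: "I \<subseteq> {0..<n}"
  then have fin: "finite I" by (rule finite_subset) simp
  note S = submatrix_index_subset[OF A I]
  have p: "pick I i < n" if "i < card I" for i
    using pick_in_set_le[OF that] I by auto
  define w where "w = vec (card I) (\<lambda>i. v $ pick I i)"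
  have w: "w \<in> carrier_vec (card I)" by (simp add: w_def)
  show "0 < det (submatrix A I I)"
  proof (rule Z_matrix_det_pos[where v = w])
    have "A $$ (pick I i, pick I j) \<le> 0" if "i < card I" "j < card I" "i \<noteq> j" for i j
    proof (rule Z_matrixD(2)[OF Z p[OF that(1)] p[OF that(2)]])
      show "pick I i \<noteq> pick I j" using inj_onD[OF inj_on_pick] that by blast
    qed
    then show "Z_matrix (card I) (submatrix A I I)"
      unfolding Z_matrix_def using S by auto
    show "w \<in> carrier_vec (card I)" by (rule w)
    show "0 < w $ i" if "i < card I" for i
      using that p v(2) by (simp add: w_def)
    show "0 < (submatrix A I I *\<^sub>v w) $ i" if i: "i < card I" for i
    proof -
      have "0 < (\<Sum>j<n. A $$ (pick I i, j) * v $ j)"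
        using Av[OF p[OF i]] mult_mat_vec_index_sum[OF A v(1) p[OF i]] by simp
      also have "\<dots> \<le> (\<Sum>j<n. if j \<in> I then A $$ (pick I i, j) * v $ j else 0)"
      proof (rule sum_mono)
        fix j assume j: "j \<in> {..<n}"
        have "A $$ (pick I i, j) * v $ j \<le> 0" if "j \<notin> I"
          using Z_matrixD(2)[OF Z p[OF i]] j that pick_in_set_le[OF i] v(2)[of j]
          by (intro mult_nonpos_nonneg) (auto simp: less_imp_le)
        then show "A $$ (pick I i, j) * v $ j \<le> (if j \<in> I then A $$ (pick I i, j) * v $ j else 0)"
          by simp
      qed
      also have "\<dots> = (\<Sum>j\<in>I. A $$ (pick I i, j) * v $ j)"
        using I by (subst sum.inter_restrict[symmetric]) (auto intro!: sum.cong)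
      also have "\<dots> = (\<Sum>j<card I. A $$ (pick I i, pick I j) * v $ pick I j)"
        by (rule sum.reindex_bij_betw[OF bij_betw_pick[OF fin], symmetric])
      also have "\<dots> = (submatrix A I I *\<^sub>v w) $ i"
        unfolding mult_mat_vec_index_sum[OF S(1) w i]
        using S(2)[OF i] by (intro sum.cong) (auto simp: w_def)
      finally show ?thesis .
    qed
  qed
qed

lemma P_matrices_det_pos:
  assumes "A \<in> P_matrices n" "0 < n"
  shows "0 < det A"
proof -
  have A: "A \<in> carrier_mat n n" using assms(1) by (simp add: P_matrices_def)
  have "submatrix A {0..<n} {0..<n} = A"
  proof (rule eq_matI)
    fix i j assume "i < dim_row A" "j < dim_col A"
    moreover have "{a \<in> {0..<n}. a < i} = {0..<i}" if "i < n" for i using that by auto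
    ultimately show "submatrix A {0..<n} {0..<n} $$ (i, j) = A $$ (i, j)"
      using submatrix_index_card[of i A j "{0..<n}" "{0..<n}"] A by simp
  qed (use submatrix_index_subset(1)[OF A order.refl] A in auto)
  then show ?thesis using assms by (auto simp: P_matrices_def)
qed

section \<open>Solvability and uniqueness for complementarity problems\<close>

text \<open>A sum of nonnegative terms vanishes only if each term does, so orthogonality splits into
  componentwise complementarity.\<close>

lemma LCP_iff:
  assumes A: "A \<in> carrier_mat n n" and q: "q \<in> carrier_vec n"
  shows "x \<in> LCP n A q \<longleftrightarrow> x \<in> carrier_vec n \<and>
    (\<forall>i<n. 0 \<le> x $ i \<and> 0 \<le> (A *\<^sub>v x) $ i + q $ i \<and> x $ i * ((A *\<^sub>v x) $ i + q $ i) = 0)"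
proof -
  have mem: "x \<in> LCP n A q \<longleftrightarrow> x \<in> carrier_vec n \<and>
    (\<forall>i<n. 0 \<le> x $ i \<and> 0 \<le> (A *\<^sub>v x) $ i + q $ i) \<and> x \<bullet> (A *\<^sub>v x + q) = 0"
  proof -
    have le: "0\<^sub>v n \<le> y \<longleftrightarrow> (\<forall>i<n. 0 \<le> y $ i)" if "y \<in> carrier_vec n" for y :: "real vec"
      using that by (simp add: less_eq_vec_def)
    have Axq: "A *\<^sub>v x + q \<in> carrier_vec n" if "x \<in> carrier_vec n"
      using A q that by (intro add_carrier_vec mult_mat_vec_carrier)
    have "(A *\<^sub>v x + q) $ i = (A *\<^sub>v x) $ i + q $ i" if "i < n" for i
      using q that by (intro index_add_vec(1)) simp
    with le Axq show ?thesis unfolding LCP_def mem_Collect_eq by metis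
  qed
  have "x \<bullet> (A *\<^sub>v x + q) = 0 \<longleftrightarrow> (\<forall>i\<in>{0..<n}. x $ i * ((A *\<^sub>v x) $ i + q $ i) = 0)"
    if "\<forall>i<n. 0 \<le> x $ i \<and> 0 \<le> (A *\<^sub>v x) $ i + q $ i"
  proof -
    have "x \<bullet> (A *\<^sub>v x + q) = (\<Sum>i\<in>{0..<n}. x $ i * ((A *\<^sub>v x) $ i + q $ i))"
      using A q by (simp add: scalar_prod_def)
    also have "\<dots> = 0 \<longleftrightarrow> (\<forall>i\<in>{0..<n}. x $ i * ((A *\<^sub>v x) $ i + q $ i) = 0)"
      using that by (intro sum_nonneg_eq_0_iff) auto
    finally show ?thesis .
  qed
  then have "(\<forall>i<n. 0 \<le> x $ i \<and> 0 \<le> (A *\<^sub>v x) $ i + q $ i) \<and> x \<bullet> (A *\<^sub>v x + q) = 0 \<longleftrightarrow>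
    (\<forall>i<n. 0 \<le> x $ i \<and> 0 \<le> (A *\<^sub>v x) $ i + q $ i \<and> x $ i * ((A *\<^sub>v x) $ i + q $ i) = 0)"
    by (meson atLeastLessThan_iff zero_le)
  then show ?thesis unfolding mem by simp
qed

text \<open>Serves both R_0 (\<open>d = 0\<close>) and E_0 (\<open>d > 0\<close>). Where
  \<open>x $ i > 0\<close>, complementarity gives \<open>(A x)_i = - d_i <= 0\<close>, so the
  maximum principle forces \<open>x <= 0\<close>.\<close>

lemma Z_matrix_LCP_nonneg:
  assumes Z: "Z_matrix n A" and v: "v \<in> carrier_vec n" "\<And>i. i < n \<Longrightarrow> 0 < v $ i"
    and Av: "\<And>i. i < n \<Longrightarrow> 0 < (A *\<^sub>v v) $ i"
    and d: "d \<in> carrier_vec n" "\<And>i. i < n \<Longrightarrow> 0 \<le> d $ i"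
  shows "LCP n A d = {0\<^sub>v n}"
proof -
  note A = Z_matrixD(1)[OF Z]
  have "0\<^sub>v n \<in> LCP n A d"
    using d by (simp add: LCP_iff[OF A d(1)] mult_mat_vec_index_sum[OF A])
  moreover have "x = 0\<^sub>v n" if "x \<in> LCP n A d" for x
  proof -
    from that have x: "x \<in> carrier_vec n"
      "\<And>i. i < n \<Longrightarrow> 0 \<le> x $ i \<and> x $ i * ((A *\<^sub>v x) $ i + d $ i) = 0"
      by (auto simp: LCP_iff[OF A d(1)])
    have "x $ i \<le> 0" if "i < n" for i
    proof (rule Z_matrix_maximum_principle[OF Z v Av x(1) _ that])
      fix i assume "i < n" "0 < x $ i"
      with x(2)[of i] d(2)[of i] show "(A *\<^sub>v x) $ i \<le> 0" by simp
    qed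
    with x show ?thesis by (intro eq_vecI) force+
  qed
  ultimately show ?thesis by blast
qed

text \<open>The componentwise infimum of the feasible set is itself feasible, hence its least
  element. It is complementary, since a positive component with positive slack could still be
  lowered.\<close>

lemma Z_matrix_LCP_of_feasible:
  assumes Z: "Z_matrix n A" and q: "q \<in> carrier_vec n" and y0: "y0 \<in> carrier_vec n"
    "\<And>i. i < n \<Longrightarrow> 0 \<le> y0 $ i" "\<And>i. i < n \<Longrightarrow> 0 \<le> (A *\<^sub>v y0) $ i + q $ i"
  shows "LCP n A q \<noteq> {}"
proof -
  note A = Z_matrixD(1)[OF Z]
  define F where "F = {y \<in> carrier_vec n. \<forall>i<n. 0 \<le> y $ i \<and> 0 \<le> (A *\<^sub>v y) $ i + q $ i}"
  have F0: "y0 \<in> F" using y0 by (simp add: F_def)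
  have Fc: "y \<in> carrier_vec n" if "y \<in> F" for y using that by (simp add: F_def)
  define x where "x = vec n (\<lambda>i. INF y\<in>F. y $ i)"
  have x: "x \<in> carrier_vec n" by (simp add: x_def)
  have bdd: "bdd_below ((\<lambda>y. y $ i) ` F)" if "i < n" for i
    by (rule bdd_belowI[of _ 0]) (use that in \<open>auto simp: F_def\<close>)
  have x_le: "x $ i \<le> y $ i" if "i < n" "y \<in> F" for i y
    using cINF_lower[OF bdd[OF that(1)] that(2)] that by (simp add: x_def)
  have x_nonneg: "0 \<le> x $ i" if "i < n" for i
    using that F0 by (auto simp: x_def F_def intro!: cINF_greatest)
  have x_feas: "0 \<le> (A *\<^sub>v x) $ i + q $ i" if i: "i < n" for i
  proof (rule ccontr)
    assume neg: "\<not> ?thesis"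
    \<comment> \<open>Passing from a feasible \<open>y\<close> down to \<open>x\<close> lowers row
      \<open>i\<close> by at most the diagonal contribution.\<close>
    have key: "0 \<le> (A *\<^sub>v x) $ i + q $ i + A $$ (i, i) * (y $ i - x $ i)" if "y \<in> F" for y
    proof -
      have "0 \<le> (A *\<^sub>v y) $ i + q $ i" using that i by (simp add: F_def)
      with Z_matrix_mult_le[OF Z x Fc[OF that] i x_le[OF _ that]] show ?thesis by simp
    qed
    show False
    proof (cases "0 < A $$ (i, i)")
      case True
      \<comment> \<open>\<open>e\<close> is the increase of component \<open>i\<close> that would
        just cancel the deficit of row \<open>i\<close>; the infimum leaves room for a feasible
        \<open>y\<close> that exceeds \<open>x $ i\<close> by less.\<close>
      define e where "e = - ((A *\<^sub>v x) $ i + q $ i) / A $$ (i, i)"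
      have "0 < e" using True neg by (simp add: e_def)
      then have "(INF y\<in>F. y $ i) < x $ i + e" using i by (simp add: x_def)
      then obtain y where y: "y \<in> F" "y $ i < x $ i + e"
        using cINF_less_iff[OF _ bdd[OF i]] F0 by auto
      then have "A $$ (i, i) * (y $ i - x $ i) < A $$ (i, i) * e"
        using True by simp
      also have "\<dots> = - ((A *\<^sub>v x) $ i + q $ i)" using True by (simp add: e_def)
      finally show False using key[OF y(1)] by simp
    next
      case False
      \<comment> \<open>With a nonpositive diagonal entry the correction cannot make up the deficit,
        so \<open>y0\<close> already contradicts \<open>key\<close>.\<close>
      then have "A $$ (i, i) * (y0 $ i - x $ i) \<le> 0"
        using x_le[OF i F0] by (simp add: mult_nonpos_nonneg)
      with key[OF F0] neg show False by simp
    qed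
  qed
  have "x $ i * ((A *\<^sub>v x) $ i + q $ i) = 0" if i: "i < n" for i
  proof (rule ccontr)
    define w where "w = (A *\<^sub>v x) $ i + q $ i"
    assume "x $ i * ((A *\<^sub>v x) $ i + q $ i) \<noteq> 0"
    then have pos: "0 < x $ i" "0 < w"
      using x_nonneg[OF i] x_feas[OF i] by (auto simp: w_def less_le)
    \<comment> \<open>The amount by which \<open>x $ i\<close> is lowered: the first bound keeps it
      nonnegative, the second keeps row \<open>i\<close> feasible, and the added 1 keeps the
      denominator positive.\<close>
    define s where "s = min (x $ i) (w / (\<bar>A $$ (i, i)\<bar> + 1))"
    have s: "0 < s" "s \<le> x $ i" using pos by (auto simp: s_def)
    have "s * A $$ (i, i) \<le> s * (\<bar>A $$ (i, i)\<bar> + 1)"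
      using s(1) by (intro mult_left_mono) auto
    also have "\<dots> \<le> w"
      using min.cobounded2[of "x $ i" "w / (\<bar>A $$ (i, i)\<bar> + 1)"]
      by (simp add: s_def[symmetric] pos_le_divide_eq)
    finally have sA: "s * A $$ (i, i) \<le> w" .
    define z where "z = vec n (\<lambda>j. if j = i then x $ i - s else x $ j)"
    have z: "z \<in> carrier_vec n" by (simp add: z_def)
    have Az: "(A *\<^sub>v z) $ k = (A *\<^sub>v x) $ k - s * A $$ (k, i)" if k: "k < n" for k
    proof -
      have "(A *\<^sub>v z) $ k = (\<Sum>j<n. A $$ (k, j) * x $ j - (if j = i then s * A $$ (k, i) else 0))"
        unfolding mult_mat_vec_index_sum[OF A z k]
        by (rule sum.cong) (auto simp: z_def algebra_simps)
      also have "\<dots> = (A *\<^sub>v x) $ k - s * A $$ (k, i)"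
        using i by (simp add: mult_mat_vec_index_sum[OF A x k] sum_subtractf)
      finally show ?thesis .
    qed
    have "0 \<le> (A *\<^sub>v z) $ k + q $ k" if k: "k < n" for k
    proof (cases "k = i")
      case True
      then show ?thesis using sA Az[OF k] by (simp add: w_def)
    next
      case False
      \<comment> \<open>Lowering component \<open>i\<close> subtracts a nonpositive amount from
        every other row.\<close>
      then have "s * A $$ (k, i) \<le> 0"
        using s(1) Z_matrixD(2)[OF Z k i] by (simp add: mult_nonneg_nonpos)
      then show ?thesis using Az[OF k] x_feas[OF k] by simp
    qed
    moreover have "0 \<le> z $ k" if "k < n" for k
      using that s(2) x_nonneg by (simp add: z_def)
    ultimately have "z \<in> F" using z by (simp add: F_def)
    from x_le[OF i this] i s(1) show False by (simp add: z_def)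
  qed
  then have "x \<in> LCP n A q"
    using x x_nonneg x_feas by (simp add: LCP_iff[OF A q])
  then show ?thesis by blast
qed

text \<open>A large enough multiple of \<open>v\<close> is feasible for any \<open>q\<close>, which
  is all that \<open>Z_matrix_LCP_of_feasible\<close> asks for.\<close>

lemma Z_matrix_Q:
  assumes Z: "Z_matrix n A" and v: "v \<in> carrier_vec n" "\<And>i. i < n \<Longrightarrow> 0 < v $ i"
    and Av: "\<And>i. i < n \<Longrightarrow> 0 < (A *\<^sub>v v) $ i"
  shows "A \<in> Q_matrices n"
  unfolding Q_matrices_def
proof (intro CollectI conjI ballI)
  note A = Z_matrixD(1)[OF Z]
  show "A \<in> carrier_mat n n" by (rule A)
  fix q :: "real vec" assume q: "q \<in> carrier_vec n"
  \<comment> \<open>A sum of nonnegative ratios bounds each of them, in place of their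
    maximum.\<close>
  define t where "t = (\<Sum>i<n. \<bar>q $ i\<bar> / (A *\<^sub>v v) $ i)"
  have nonneg: "0 \<le> \<bar>q $ i\<bar> / (A *\<^sub>v v) $ i" if "i < n" for i
    using Av[OF that] by simp
  have t: "0 \<le> t" unfolding t_def using nonneg by (intro sum_nonneg) auto
  show "LCP n A q \<noteq> {}"
  proof (rule Z_matrix_LCP_of_feasible[OF Z q])
    show "t \<cdot>\<^sub>v v \<in> carrier_vec n" using v(1) by simp
    show "0 \<le> (t \<cdot>\<^sub>v v) $ i" if "i < n" for i
      using that v t by (simp add: less_imp_le)
    show "0 \<le> (A *\<^sub>v (t \<cdot>\<^sub>v v)) $ i + q $ i" if i: "i < n" for i
    proof -
      have "\<bar>q $ i\<bar> / (A *\<^sub>v v) $ i \<le> t"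
        unfolding t_def using nonneg i by (intro member_le_sum) auto
      then have "\<bar>q $ i\<bar> \<le> t * (A *\<^sub>v v) $ i"
        using Av[OF i] by (simp add: pos_divide_le_eq)
      moreover have "(A *\<^sub>v (t \<cdot>\<^sub>v v)) $ i = t * (A *\<^sub>v v) $ i"
        using mult_mat_vec[OF A v(1)] A i by simp
      ultimately show ?thesis by linarith
    qed
  qed
qed

text \<open>A solution \<open>x\<close> for \<open>q = -(1,...,1)\<close> has \<open>A x > 0\<close>
  and is itself positive, so it can act as the positive vector of the maximum principle; applied to
  \<open>v\<close>, this gives \<open>v <= 0\<close>.\<close>

lemma Z_matrix_not_Q:
  assumes Z: "Z_matrix n A" and n: "0 < n"
    and v: "v \<in> carrier_vec n" "\<And>i. i < n \<Longrightarrow> 0 < v $ i"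
    and Av: "\<And>i. i < n \<Longrightarrow> (A *\<^sub>v v) $ i \<le> 0"
  shows "A \<notin> Q_matrices n"
proof
  note A = Z_matrixD(1)[OF Z]
  assume Q: "A \<in> Q_matrices n"
  define q where "q = vec n (\<lambda>_. - 1 :: real)"
  have q: "q \<in> carrier_vec n" by (simp add: q_def)
  with Q obtain x where "x \<in> LCP n A q" by (auto simp: Q_matrices_def)
  then have x: "x \<in> carrier_vec n" "\<And>i. i < n \<Longrightarrow> 0 \<le> x $ i"
    "\<And>i. i < n \<Longrightarrow> 1 \<le> (A *\<^sub>v x) $ i"
    unfolding LCP_iff[OF A q] by (auto simp: q_def)
  have Ax: "0 < (A *\<^sub>v x) $ i" if "i < n" for i using x(3)[OF that] by simp
  have "0 < x $ i" if i: "i < n" for i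
  proof (rule ccontr)
    assume "\<not> 0 < x $ i"
    with x(2)[OF i] have "x $ i = 0" by simp
    \<comment> \<open>Comparison with the zero vector, where \<open>x $ i = 0\<close> removes the
      diagonal correction.\<close>
    with Z_matrix_mult_le[OF Z _ x(1) i, of "0\<^sub>v n"] x i
    have "(A *\<^sub>v x) $ i \<le> 0" by (simp add: mult_mat_vec_index_sum[OF A])
    with Ax[OF i] show False by simp
  qed
  from Z_matrix_maximum_principle[OF Z x(1) this Ax v(1) Av n] v(2)[OF n]
  show False by simp
qed

text \<open>The nonzero \<open>v\<close> solves \<open>LCP(A, - A v)\<close>; a vanishing
  \<open>A v\<close> violates R_0 and a negative one violates E_0, hence the two
  alternatives.\<close>

lemma not_Rstar:
  assumes A: "A \<in> carrier_mat n n" and n: "0 < n"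
    and v: "v \<in> carrier_vec n" "\<And>i. i < n \<Longrightarrow> 0 < v $ i"
    and Av: "(\<forall>i<n. (A *\<^sub>v v) $ i = 0) \<or> (\<forall>i<n. (A *\<^sub>v v) $ i < 0)"
  shows "A \<notin> Rstar_matrices n"
proof
  assume R: "A \<in> Rstar_matrices n"
  define d where "d = - (A *\<^sub>v v)"
  have d: "d \<in> carrier_vec n" "\<And>i. i < n \<Longrightarrow> d $ i = - (A *\<^sub>v v) $ i"
    using A by (auto simp: d_def intro!: carrier_vecI)
  from Av have "d = 0\<^sub>v n \<or> (\<forall>i<n. 0 < d $ i)"
    using d by (metis carrier_vecD eq_vecI index_zero_vec neg_0_equal_iff_equal neg_0_less_iff_less)
  then have "LCP n A d = {0\<^sub>v n}"
    using R d(1) by (auto simp: Rstar_matrices_def R0_matrices_def E0_matrices_def)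
  moreover have "v \<in> LCP n A d"
    using v d by (simp add: LCP_iff[OF A d(1)] less_imp_le)
  ultimately show False using v(2)[OF n] n by auto
qed

section \<open>Determinant and balancing vector of bidiagonal southwest matrices\<close>

text \<open>Column 0 can be nonzero only in the first and last rows, and the minors there are
  triangular. The sign of the corner cofactor is absorbed by negating the superdiagonal
  entries.\<close>

lemma bdsw_det:
  assumes "bdsw n A"
  shows "det A = (\<Prod>i<n. A $$ (i, i)) -
    (\<Prod>i<n. - A $$ (i, if i = n - 1 then 0 else i + 1))"
proof -
  define m where "m = n - 1"
  have n: "n = Suc m" "0 < m" and A: "A \<in> carrier_mat (Suc m) (Suc m)"
    using assms by (auto simp: bdsw_def m_def)
  have zero: "A $$ (i, j) = 0"
    if "i < Suc m" "j < Suc m" "j \<noteq> i" "j \<noteq> i + 1" "i \<noteq> m \<or> j \<noteq> 0" for i j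
    using assms that by (auto simp: bdsw_def n)
  \<comment> \<open>Deleting row 0 and column 0 keeps the remaining diagonal; deleting row
    \<open>m\<close> and column 0 moves the superdiagonal onto the diagonal.\<close>
  define U where "U = mat_delete A 0 0"
  define L where "L = mat_delete A m 0"
  have dims: "U \<in> carrier_mat m m" "L \<in> carrier_mat m m"
    using A by (simp_all add: U_def L_def mat_delete_def)
  have U: "U $$ (i, j) = A $$ (Suc i, Suc j)" and L: "L $$ (i, j) = A $$ (i, Suc j)"
    if "i < m" "j < m" for i j
    using A that by (auto simp: U_def L_def mat_delete_def)
  have "upper_triangular U"
    using dims U zero by (auto simp: upper_triangular_def)
  then have "det U = prod_list (diag_mat U)"
    using dims(1) by (rule det_upper_triangular)
  also have "\<dots> = (\<Prod>i<m. A $$ (Suc i, Suc i))"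
    using dims(1) U by (auto simp: prod_list_diag_prod atLeast0LessThan intro!: prod.cong)
  finally have dU: "det U = (\<Prod>i<m. A $$ (Suc i, Suc i))" .
  have "det L = prod_list (diag_mat L)"
    using L zero by (intro det_lower_triangular[OF _ dims(2)]) auto
  also have "\<dots> = (\<Prod>i<m. A $$ (i, Suc i))"
    using dims(2) L by (auto simp: prod_list_diag_prod atLeast0LessThan intro!: prod.cong)
  finally have dL: "det L = (\<Prod>i<m. A $$ (i, Suc i))" .
  have "det A = (\<Sum>i<Suc m. A $$ (i, 0) * cofactor A i 0)"
    by (rule laplace_expansion_column[OF A]) simp
  also have "\<dots> = (\<Sum>i\<in>{0, m}. A $$ (i, 0) * cofactor A i 0)"
    using zero by (intro sum.mono_neutral_right) auto
  also have "\<dots> = A $$ (0, 0) * det U + A $$ (m, 0) * ((-1) ^ m * det L)"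
    using n(2) by (simp add: cofactor_def U_def L_def)
  also have "A $$ (0, 0) * det U = (\<Prod>i<n. A $$ (i, i))"
    unfolding dU n(1) by (rule prod.lessThan_Suc_shift[symmetric])
  also have "(\<Prod>i<n. - A $$ (i, if i = n - 1 then 0 else i + 1)) =
      (\<Prod>i<m. - A $$ (i, Suc i)) * - A $$ (m, 0)"
    by (simp add: n(1))
  moreover have "(\<Prod>i<m. - A $$ (i, Suc i)) = (-1) ^ m * det L"
    by (simp add: dL prod_uminus)
  ultimately show ?thesis by simp
qed

lemma type_II_bdsw_Z_matrix:
  assumes "type_II_bdsw n A"
  shows "Z_matrix n A"
  unfolding Z_matrix_def
proof (intro conjI allI impI)
  show "A \<in> carrier_mat n n" using assms by (simp add: type_II_bdsw_def bdsw_def)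
  fix i j assume ij: "i < n" "j < n" "i \<noteq> j"
  consider "j = i + 1" | "i = n - 1" "j = 0" | "\<not> (j = i \<or> j = i + 1 \<or> (i = n - 1 \<and> j = 0))"
    using ij by blast
  then show "A $$ (i, j) \<le> 0"
  proof cases
    case 1
    then have "A $$ (i, i + 1) < 0" using assms ij by (simp add: type_II_bdsw_def)
    then show ?thesis using 1 by simp
  next
    case 2
    then show ?thesis using assms by (simp add: type_II_bdsw_def)
  next
    case 3
    then show ?thesis using assms ij by (simp add: type_II_bdsw_def bdsw_def)
  qed
qed

lemma bdsw_mult_vec:
  assumes "bdsw n A" "x \<in> carrier_vec n" "i < n"
  shows "(A *\<^sub>v x) $ i = A $$ (i, i) * x $ i +
    A $$ (i, if i = n - 1 then 0 else i + 1) * x $ (if i = n - 1 then 0 else i + 1)"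
proof -
  define j where "j = (if i = n - 1 then 0 else i + 1)"
  have A: "A \<in> carrier_mat n n" and j: "j < n" "j \<noteq> i"
    using assms by (auto simp: bdsw_def j_def)
  have "(A *\<^sub>v x) $ i = (\<Sum>k\<in>{i, j}. A $$ (i, k) * x $ k)"
    unfolding mult_mat_vec_index_sum[OF A assms(2,3)]
    using assms j by (intro sum.mono_neutral_right) (auto simp: bdsw_def j_def)
  then show ?thesis using j(2) by (simp add: j_def)
qed

lemma type_II_bdsw_positive_vector:
  assumes T: "type_II_bdsw n A"
  obtains v where "v \<in> carrier_vec n" "\<And>i. i < n \<Longrightarrow> 0 < v $ i"
    "\<And>i. i < n \<Longrightarrow> sgn ((A *\<^sub>v v) $ i) = sgn (det A)"
proof -
  have B: "bdsw n A" and n: "2 \<le> n" and diag: "\<And>i. i < n \<Longrightarrow> 0 < A $$ (i, i)"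
    using T by (auto simp: type_II_bdsw_def bdsw_def)
  define b where "b i = - A $$ (i, if i = n - 1 then 0 else i + 1)" for i
  have b: "0 < b i" if "i < n" for i
    using T that by (auto simp: type_II_bdsw_def b_def)
  define D where "D = (\<Prod>i<n. A $$ (i, i))"
  define P where "P = (\<Prod>i<n. b i)"
  have DP: "0 < D" "0 < P" using diag b by (auto simp: D_def P_def intro!: prod_pos)
  have det: "det A = D - P" using bdsw_det[OF B] by (simp add: D_def P_def b_def)
  \<comment> \<open>One turn around the cycle multiplies by \<open>D / (P * c ^ n)\<close>; this
    root makes the factor 1.\<close>
  define c where "c = root n (D / P)"
  have c: "0 < c" using DP n by (simp add: c_def)
  have cn: "c ^ n = D / P" using DP n by (simp add: c_def)
  \<comment> \<open>Solves the balance equations row by row from \<open>f 0 = 1\<close>, the empty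
    product.\<close>
  define f where "f i = (\<Prod>j<i. A $$ (j, j) / (b j * c))" for i
  have f: "0 < f i" if "i \<le> n" for i
    using that diag b c by (auto simp: f_def intro!: prod_pos)
  have fn: "f n = 1"
    using DP cn by (simp add: f_def prod_dividef prod.distrib D_def[symmetric] P_def[symmetric])
  have f_Suc: "b i * f (Suc i) = A $$ (i, i) * f i / c" if "i < n" for i
    using b[OF that] c by (simp add: f_def)
  define v where "v = vec n f"
  have v: "v \<in> carrier_vec n" by (simp add: v_def)
  have "(A *\<^sub>v v) $ i = A $$ (i, i) * f i / c * (c - 1)" if i: "i < n" for i
  proof -
    \<comment> \<open>In the last row the neighbour is component 0, and \<open>f n = f 0 = 1\<close>
      closes the cycle.\<close>
    have "v $ (if i = n - 1 then 0 else i + 1) = f (Suc i)"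
    proof (cases "i = n - 1")
      case True
      then have "Suc i = n" using n by simp
      moreover have "f 0 = 1" by (simp add: f_def)
      ultimately show ?thesis using True fn n by (simp add: v_def)
    qed (use i in \<open>simp add: v_def\<close>)
    then have "(A *\<^sub>v v) $ i = A $$ (i, i) * f i - b i * f (Suc i)"
      unfolding bdsw_mult_vec[OF B v i] b_def using i by (simp add: v_def)
    also have "\<dots> = A $$ (i, i) * f i / c * (c - 1)"
      using c by (simp add: f_Suc[OF i] field_simps)
    finally show ?thesis .
  qed
  \<comment> \<open>The root \<open>c\<close> lies below, at or above 1 exactly as
    \<open>D / P\<close> does, and \<open>det A\<close> is \<open>D - P\<close>.\<close>
  moreover have "sgn (c - 1) = sgn (det A)"
  proof -
    have "(c < 1 \<longleftrightarrow> D < P) \<and> (c = 1 \<longleftrightarrow> D = P)"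
      using DP n by (auto simp: c_def)
    then show ?thesis by (auto simp: det sgn_if)
  qed
  ultimately have "sgn ((A *\<^sub>v v) $ i) = sgn (det A)" if "i < n" for i
    using that diag f[of i] c by (simp add: sgn_mult)
  moreover have "0 < v $ i" if "i < n" for i using that f[of i] by (simp add: v_def)
  ultimately show ?thesis using that v by blast
qed

theorem theorem6p1:
  fixes A :: "real mat" and n :: nat
  assumes "type_II_bdsw n A"
  shows "(A \<in> Q_matrices n \<longleftrightarrow> A \<in> P_matrices n) \<and>
         (A \<in> Q_matrices n \<longleftrightarrow> A \<in> Rstar_matrices n) \<and>
         (A \<in> Q_matrices n \<longleftrightarrow> 0 < det A)"
proof -
  note Z = type_II_bdsw_Z_matrix[OF assms]
  note A = Z_matrixD(1)[OF Z]
  have n: "0 < n" using assms by (simp add: type_II_bdsw_def bdsw_def)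
  obtain v where v: "v \<in> carrier_vec n" "\<And>i. i < n \<Longrightarrow> 0 < v $ i"
    and sgn: "\<And>i. i < n \<Longrightarrow> sgn ((A *\<^sub>v v) $ i) = sgn (det A)"
    using type_II_bdsw_positive_vector[OF assms] by blast
  show ?thesis
  proof (cases "0 < det A")
    case True
    then have Av: "0 < (A *\<^sub>v v) $ i" if "i < n" for i
      using sgn[OF that] by (simp add: sgn_1_pos)
    have "A \<in> Rstar_matrices n"
      using A Z_matrix_LCP_nonneg[OF Z v Av]
      by (auto simp: Rstar_matrices_def R0_matrices_def E0_matrices_def less_imp_le)
    then show ?thesis
      using True Z_matrix_P[OF Z v Av] Z_matrix_Q[OF Z v Av] by blast
  next
    case False
    \<comment> \<open>All components of \<open>A v\<close> share the sign of \<open>det A\<close>,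
      so zeros and negative values do not mix.\<close>
    then have cases: "(\<forall>i<n. (A *\<^sub>v v) $ i = 0) \<or> (\<forall>i<n. (A *\<^sub>v v) $ i < 0)"
      using sgn by (cases "det A = 0") (auto simp: sgn_0_0 sgn_1_neg)
    then have "(A *\<^sub>v v) $ i \<le> 0" if "i < n" for i using that by force
    \<comment> \<open>Here all the properties fail together; P fails because \<open>det A\<close> is
      itself a principal minor.\<close>
    from Z_matrix_not_Q[OF Z n v this] not_Rstar[OF A n v cases]
    show ?thesis using False P_matrices_det_pos[OF _ n] by blast
  qed
qed

end
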